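(* A solution to The Hardest Logic Puzzle Ever exists. That is, there is an adaptive strategy of at most three yes/no questions, each directed at one god, which determines with certainty which of the three gods is the truthful one, which is the lying one and which is the random one.
   Context: The Hardest Logic Puzzle Ever: there are three distinguishable gods $\gamma_1,\gamma_2,\gamma_3$. One of them ($\mathcal{T}$) always tells the truth, one ($\mathcal{F}$) always lies, and one ($\mathcal{R}$) answers truly randomly, so that it may give either answer to any question. It is not known which god is which. Three yes/no questions may be asked, each directed at one god of the solver's choice, and they may be chosen adaptively. The gods understand the questions but answer with one of two words, one of which is `$\chi$'. One of the two words means yes and the other means no, and the solver does not know which (and need not find out). A question is any yes/no question having a definite truth value given the actual state (the identities of the gods and the meaning of $\chi$), including hypothetical questions to a non-random god about how that god would answer some other question. $\mathcal{T}$ gives the word for the true answer and $\mathcal{F}$ gives the word for the opposite of the true answer. The strategy must succeed for every assignment of identities, for either meaning of $\chi$, and whatever answers $\mathcal{R}$ happens to give. *)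

theory Defs
  imports Main
begin

datatype god = God1 | God2 | God3

datatype role = Truthful | Lying | Random

datatype answer_word = Chi | NotChi

datatype puzzle_state = State (identity: "god \<Rightarrow> role") (yes_word: answer_word)

definition admissible :: "puzzle_state \<Rightarrow> bool" where
  "admissible s \<longleftrightarrow> bij (identity s)"

definition means_yes :: "puzzle_state \<Rightarrow> answer_word \<Rightarrow> bool" where
  "means_yes s w \<longleftrightarrow> w = yes_word s"

text \<open>
  A question is identified with its truth value as a function of the state. Hypothetical questions
  are included: what a non-random god would say to a question is itself determined by the state.
  For a question put to the random god, the truth value plays no role.
\<close>

type_synonym question = "puzzle_state \<Rightarrow> bool"

definition may_answer :: "puzzle_state \<Rightarrow> god \<Rightarrow> question \<Rightarrow> answer_word \<Rightarrow> bool" where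
  "may_answer s g q w \<longleftrightarrow>
    (case identity s g of
       Truthful \<Rightarrow> means_yes s w \<longleftrightarrow> q s
     | Lying \<Rightarrow> means_yes s w \<longleftrightarrow> \<not> q s
     | Random \<Rightarrow> True)"

text \<open>
  A strategy is a decision tree: after asking a god a question, the solver continues according to
  the word heard, and finally announces who is who.
\<close>

datatype strategy =
    Conclude "god \<Rightarrow> role"
  | Ask god question "answer_word \<Rightarrow> strategy"

primrec max_questions :: "strategy \<Rightarrow> nat" where
  "max_questions (Conclude c) = 0"
| "max_questions (Ask g q k) = Suc (max (max_questions (k Chi)) (max_questions (k NotChi)))"

primrec possible_conclusions :: "puzzle_state \<Rightarrow> strategy \<Rightarrow> (god \<Rightarrow> role) set" where
  "possible_conclusions s (Conclude c) = {c}"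
| "possible_conclusions s (Ask g q k) =
    (\<Union>w\<in>{w. may_answer s g q w}. possible_conclusions s (k w))"

definition solves_puzzle :: "strategy \<Rightarrow> bool" where
  "solves_puzzle \<sigma> \<longleftrightarrow>
    (\<forall>s. admissible s \<longrightarrow> possible_conclusions s \<sigma> = {identity s})"

end

theory Submission
  imports Defs
begin

text \<open>
  Why three questions suffice. A god who is not random can be made to reveal any fact \<open>p\<close>, whatever
  the words mean and whether or not he lies: ask him whether he could answer \<open>\<chi>\<close> to \<open>p\<close>. A liar then
  negates twice, once in the hypothetical answer and once in the actual one, and the meaning of
  \<open>\<chi>\<close> also enters twice, so both unknowns cancel and he says \<open>\<chi>\<close> exactly when \<open>p\<close> holds
  (lemma \<open>may_answer_embed_iff\<close>).

  It remains to find a god who is not random with a single question, which may itself be put to the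
  random god. Ask the first god in this way whether the second is random. If the first god is
  random, both others are safe and the answer does not matter; otherwise the answer is reliable.
  So after \<open>\<chi>\<close> the third god is not random, and after the other word the second is not random.
  Two embedded questions to this safe god, whether he is truthful and whether the first god is
  random, then distinguish the four remaining assignments of roles.
\<close>

definition embed :: "god \<Rightarrow> question \<Rightarrow> question" where
  "embed g p = (\<lambda>s. may_answer s g p Chi)"

text \<open>
  For the truthful god, \<open>w\<close> is a possible answer when
  \<open>(w = yes_word s) = ((Chi = yes_word s) = p s)\<close>; for the liar two negations are added to this
  equivalence and cancel. As there are only two words, \<open>w\<close> and \<open>Chi\<close> agree on being the word for
  yes exactly when they are equal, so \<open>yes_word s\<close> drops out.
\<close>

lemma may_answer_embed_iff:
  "may_answer s g (embed g p) w \<longleftrightarrow> identity s g = Random \<or> (w = Chi \<longleftrightarrow> p s)"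
  by (cases "identity s g"; cases w; cases "yes_word s")
     (auto simp: may_answer_def means_yes_def embed_def)

lemma possible_conclusions_embed:
  assumes "identity s g \<noteq> Random"
  shows "possible_conclusions s (Ask g (embed g p) k) =
           possible_conclusions s (k (if p s then Chi else NotChi))"
proof -
  have "{w. may_answer s g (embed g p) w} = {if p s then Chi else NotChi}"
    using assms answer_word.exhaust by (auto simp: may_answer_embed_iff)
  then show ?thesis
    by simp
qed

definition roles_from :: "god \<Rightarrow> bool \<Rightarrow> bool \<Rightarrow> god \<Rightarrow> role" where
  "roles_from h truthful first_random = (\<lambda>g.
     if g = h then (if truthful then Truthful else Lying)
     else if g = God1 \<longleftrightarrow> first_random then Random
     else (if truthful then Lying else Truthful))"

text \<open>
  Apart from \<open>h\<close> there is one god besides the first. As \<open>h\<close> is not random, exactly one of these two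
  is, and the other has the role opposite to that of \<open>h\<close>.
\<close>

lemma roles_from_identity:
  assumes "admissible s" "h \<noteq> God1" "identity s h \<noteq> Random"
  shows "roles_from h (identity s h = Truthful) (identity s God1 = Random) = identity s"
proof
  fix g
  have distinct: "identity s a \<noteq> identity s b" if "a \<noteq> b" for a b
    using assms(1) that by (auto simp: admissible_def bij_def inj_def)
  show "roles_from h (identity s h = Truthful) (identity s God1 = Random) g = identity s g"
    using assms(2,3) distinct[of God1 God2] distinct[of God1 God3] distinct[of God2 God3]
    by (cases h; cases g; cases "identity s God1"; cases "identity s God2";
        cases "identity s God3")
       (auto simp: roles_from_def)
qed

definition interrogate :: "god \<Rightarrow> strategy" where
  "interrogate h =
     Ask h (embed h (\<lambda>s. identity s h = Truthful)) (\<lambda>v.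
     Ask h (embed h (\<lambda>s. identity s God1 = Random)) (\<lambda>w.
     Conclude (roles_from h (v = Chi) (w = Chi))))"

lemma possible_conclusions_interrogate:
  assumes "admissible s" "h \<noteq> God1" "identity s h \<noteq> Random"
  shows "possible_conclusions s (interrogate h) = {identity s}"
proof -
  have "((if P then Chi else NotChi) = Chi) = P" for P
    by simp
  then show ?thesis
    using roles_from_identity[OF assms] assms(3)
    by (simp add: interrogate_def possible_conclusions_embed
        del: possible_conclusions.simps(2))
qed

definition solution :: strategy where
  "solution = Ask God1 (embed God1 (\<lambda>s. identity s God2 = Random))
     (\<lambda>w. interrogate (case w of Chi \<Rightarrow> God3 | NotChi \<Rightarrow> God2))"

lemma solves_puzzle_solution: "solves_puzzle solution"
  unfolding solves_puzzle_def
proof (intro allI impI)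
  fix s
  assume adm: "admissible s"
  then have inj: "inj (identity s)"
    by (simp add: admissible_def bij_def)
  let ?q = "embed God1 (\<lambda>s. identity s God2 = Random)"
  let ?next = "\<lambda>w. case w of Chi \<Rightarrow> God3 | NotChi \<Rightarrow> God2"
  have branch: "possible_conclusions s (interrogate (?next w)) = {identity s}"
    if "may_answer s God1 ?q w" for w
  proof (rule possible_conclusions_interrogate[OF adm])
    show "?next w \<noteq> God1"
      by (cases w) auto
    show "identity s (?next w) \<noteq> Random"
      using that inj_eq[OF inj, of God1 God2] inj_eq[OF inj, of God1 God3]
        inj_eq[OF inj, of God2 God3]
      by (cases w) (auto simp: may_answer_embed_iff)
  qed
  \<comment> \<open>Without some possible answer the set of conclusions would be empty.\<close>
  have "\<exists>w. may_answer s God1 ?q w"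
    using answer_word.distinct(1) by (metis may_answer_embed_iff)
  then show "possible_conclusions s solution = {identity s}"
    using branch by (auto simp: solution_def)
qed

theorem mainTheorem4:
  "\<exists>\<sigma>. max_questions \<sigma> \<le> 3 \<and> solves_puzzle \<sigma>"
proof (intro exI conjI)
  show "max_questions solution \<le> 3"
    by (simp add: solution_def interrogate_def)
qed (rule solves_puzzle_solution)

end
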